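(* There are a sequence $(c_n)$ of positive reals with $c_n\to0$ and a function $f:\mathbb N\to\mathbb N$ with $f(n)\to\infty$, satisfying $$\log(1/c_n)=o(\log n),\qquad f(n)\log(1/c_n)=o(\log n),$$ for which the pruned graphs $\mathrm{Prune}_{f(n)}(G(n,c_n/n))$ do not have a first-order zero--one law.
   Context: $G(n,p)$ is the random graph on vertex set $[n]=\{1,\dots,n\}$ in which each edge is present independently with probability $p$ (for finitely many small $n$ with $c_n/n>1$ the model may be defined arbitrarily). $\mathbb N$ denotes the positive integers. For a finite graph $G$ and an integer $m\ge 1$, $\mathrm{Prune}_m(G)$ is the subgraph of $G$ induced on $\{v\in V(G): |C_G(v)|\ge m\}$, where $C_G(v)$ is the connected component of $v$; that is, every component with fewer than $m$ vertices is deleted. First-order logic of graphs uses one binary symbol $E$ interpreted as symmetric irreflexive adjacency. A sequence of random graphs has a first-order zero--one law if for every first-order sentence $\varphi$ the probability that the $n$th graph satisfies $\varphi$ converges to $0$ or to $1$. *)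

theory Defs
  imports "HOL-Probability.Probability" "HOL-Probability.Product_PMF" "HOL-Library.Landau_Symbols"
begin

section \<open>Finite simple graphs and pruning\<close>

record 'v graph =
  verts :: "'v set"
  edges :: "'v set set"

definition simple_graph :: "'v graph \<Rightarrow> bool" where
  "simple_graph G \<longleftrightarrow> finite (verts G) \<and> (\<forall>e\<in>edges G. e \<subseteq> verts G \<and> card e = 2)"

definition adj :: "'v graph \<Rightarrow> 'v \<Rightarrow> 'v \<Rightarrow> bool" where
  "adj G u v \<longleftrightarrow> {u, v} \<in> edges G"

definition component :: "'v graph \<Rightarrow> 'v \<Rightarrow> 'v set" where
  "component G v = {w \<in> verts G. (adj G)\<^sup>*\<^sup>* v w}"

definition induced :: "'v graph \<Rightarrow> 'v set \<Rightarrow> 'v graph" where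
  "induced G S = \<lparr>verts = verts G \<inter> S, edges = {e \<in> edges G. e \<subseteq> S}\<rparr>"

definition prune :: "nat \<Rightarrow> 'v graph \<Rightarrow> 'v graph" where
  "prune m G = induced G {v \<in> verts G. card (component G v) \<ge> m}"

lemma adj_sym: "adj G u v \<longleftrightarrow> adj G v u"
  by (simp add: adj_def insert_commute)

lemma simple_graph_adj_irrefl: "simple_graph G \<Longrightarrow> \<not> adj G v v"
  by (auto simp: simple_graph_def adj_def)

lemma simple_graph_prune: "simple_graph G \<Longrightarrow> simple_graph (prune m G)"
  by (auto simp: simple_graph_def prune_def induced_def)

section \<open>The binomial random graph\<close>

definition vertex_pairs :: "nat \<Rightarrow> nat set set" where
  "vertex_pairs n = {e. e \<subseteq> {1..n} \<and> card e = 2}"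

text \<open>The library clamps the parameter of \<^const>\<open>bernoulli_pmf\<close> to the unit interval,
  so this is also defined for \<^term>\<open>p > 1\<close>.\<close>

definition gnp :: "nat \<Rightarrow> real \<Rightarrow> nat graph pmf" where
  "gnp n p = map_pmf (\<lambda>x. \<lparr>verts = {1..n}, edges = {e \<in> vertex_pairs n. x e}\<rparr>)
     (Pi_pmf (vertex_pairs n) False (\<lambda>_. bernoulli_pmf p))"

lemma simple_graph_gnp: "G \<in> set_pmf (gnp n p) \<Longrightarrow> simple_graph G"
proof -
  assume "G \<in> set_pmf (gnp n p)"
  then obtain x where "G = \<lparr>verts = {1..n}, edges = {e \<in> vertex_pairs n. x e}\<rparr>"
    unfolding gnp_def set_map_pmf by blast
  then show ?thesis
    by (simp add: simple_graph_def vertex_pairs_def)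
qed

section \<open>First-order logic of graphs\<close>

datatype fo_formula =
    Equal nat nat
  | Adjacent nat nat
  | Neg fo_formula
  | Conj fo_formula fo_formula
  | Exists nat fo_formula

primrec free_vars :: "fo_formula \<Rightarrow> nat set" where
  "free_vars (Equal x y) = {x, y}"
| "free_vars (Adjacent x y) = {x, y}"
| "free_vars (Neg \<phi>) = free_vars \<phi>"
| "free_vars (Conj \<phi> \<psi>) = free_vars \<phi> \<union> free_vars \<psi>"
| "free_vars (Exists x \<phi>) = free_vars \<phi> - {x}"

definition sentence :: "fo_formula \<Rightarrow> bool" where
  "sentence \<phi> \<longleftrightarrow> free_vars \<phi> = {}"

primrec sat :: "'v graph \<Rightarrow> (nat \<Rightarrow> 'v) \<Rightarrow> fo_formula \<Rightarrow> bool" where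
  "sat G \<sigma> (Equal x y) \<longleftrightarrow> \<sigma> x = \<sigma> y"
| "sat G \<sigma> (Adjacent x y) \<longleftrightarrow> adj G (\<sigma> x) (\<sigma> y)"
| "sat G \<sigma> (Neg \<phi>) \<longleftrightarrow> \<not> sat G \<sigma> \<phi>"
| "sat G \<sigma> (Conj \<phi> \<psi>) \<longleftrightarrow> sat G \<sigma> \<phi> \<and> sat G \<sigma> \<psi>"
| "sat G \<sigma> (Exists x \<phi>) \<longleftrightarrow> (\<exists>v\<in>verts G. sat G (\<sigma>(x := v)) \<phi>)"

lemma sat_cong:
  "(\<And>x. x \<in> free_vars \<phi> \<Longrightarrow> \<sigma> x = \<tau> x) \<Longrightarrow> sat G \<sigma> \<phi> \<longleftrightarrow> sat G \<tau> \<phi>"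
proof (induction \<phi> arbitrary: \<sigma> \<tau>)
  case (Equal x y)
  from Equal[of x] Equal[of y] show ?case by simp
next
  case (Adjacent x y)
  from Adjacent[of x] Adjacent[of y] show ?case by simp
next
  case (Neg \<phi>)
  have "sat G \<sigma> \<phi> \<longleftrightarrow> sat G \<tau> \<phi>"
    by (rule Neg.IH, rule Neg.prems) simp
  then show ?case by simp
next
  case (Conj \<phi> \<psi>)
  have "sat G \<sigma> \<phi> \<longleftrightarrow> sat G \<tau> \<phi>"
    by (rule Conj.IH(1), rule Conj.prems) simp
  moreover have "sat G \<sigma> \<psi> \<longleftrightarrow> sat G \<tau> \<psi>"
    by (rule Conj.IH(2), rule Conj.prems) simp
  ultimately show ?case by simp
next
  case (Exists x \<phi>)
  have "sat G (\<sigma>(x := v)) \<phi> \<longleftrightarrow> sat G (\<tau>(x := v)) \<phi>" for v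
  proof (rule Exists.IH)
    fix y assume "y \<in> free_vars \<phi>"
    then have "\<sigma> y = \<tau> y" if "y \<noteq> x"
      using that by (intro Exists.prems) simp
    then show "(\<sigma>(x := v)) y = (\<tau>(x := v)) y"
      unfolding fun_upd_apply by metis
  qed
  then show ?case by simp
qed

text \<open>Assignments are not required to take values in \<^term>\<open>verts G\<close>, since a pruned graph may have
  no vertices. For a sentence the assignment is irrelevant, by the preceding lemma.\<close>

definition satisfies :: "'v graph \<Rightarrow> fo_formula \<Rightarrow> bool" where
  "satisfies G \<phi> \<longleftrightarrow> (\<forall>\<sigma>. sat G \<sigma> \<phi>)"

definition fo_zero_one_law :: "(nat \<Rightarrow> 'v graph pmf) \<Rightarrow> bool" where
  "fo_zero_one_law M \<longleftrightarrow> (\<forall>\<phi>. sentence \<phi> \<longrightarrow>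
     (\<lambda>n. measure_pmf.prob (M n) {G. satisfies G \<phi>}) \<longlonglongrightarrow> 0 \<or>
     (\<lambda>n. measure_pmf.prob (M n) {G. satisfies G \<phi>}) \<longlonglongrightarrow> 1)"

end

theory Submission
  imports Defs "HOL-Real_Asymp.Real_Asymp"
begin

text \<open>
  Every component of \<^term>\<open>prune m G\<close> has at least \<open>m\<close> vertices, so a property of components that
  only highly symmetric trees have can disappear when \<open>m\<close> grows. The conditions on \<open>c\<close> and \<open>f\<close>
  make the expected number of copies of a tree of size \<open>f n\<close> large as long as its automorphism group
  is small, because that number is about \<open>n c\<^sup>k / a\<close> for a tree with \<open>k\<close> edges and \<open>a\<close>
  automorphisms. A star with \<open>k\<close> leaves has \<open>k!\<close> automorphisms, and \<open>k!\<close> exceeds \<open>n\<close> well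
  before \<open>k log (1/c)\<close> reaches the order of \<open>log n\<close>, provided that \<open>c\<close> tends to zero slowly.

  Let \<open>l = 1 + ln (1 + ln n)\<close> and \<open>c = 1 / l\<close>. The sentence says that some component is a star.
  If \<open>f n\<close> is of order \<open>ln n / sqrt l\<close>, a star component that survives pruning needs a vertex of
  degree about \<open>f n\<close>, and the expected number of such vertices tends to zero
  (\<open>prob_star_sentence_le\<close>, a first-moment bound). If \<open>f n\<close> is of order \<open>sqrt l\<close>, there are many
  star components with exactly \<open>f n\<close> vertices, by a second-moment bound
  (\<open>prob_star_sentence_ge\<close>). Using the first choice for odd \<open>n\<close> and the second for even \<open>n\<close>, the
  probability of the sentence stays below \<open>1/4\<close> along one subsequence and above \<open>1/2\<close> along the
  other.
\<close>

section \<open>A first-order sentence about stars\<close>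

text \<open>The sentence asks for a vertex (variable 0) whose neighbours (variable 1) have no neighbours
  (variable 2) besides it. The component of that vertex is then a star, possibly a single vertex or
  a single edge.\<close>

definition star_sentence :: fo_formula where
  "star_sentence = Exists 0 (Neg (Exists 1 (Conj (Adjacent 1 0)
     (Exists 2 (Conj (Adjacent 2 1) (Neg (Equal 2 0)))))))"

lemma sentence_star_sentence: "sentence star_sentence"
  by (auto simp: sentence_def star_sentence_def)

lemma satisfies_star_sentence:
  "satisfies G star_sentence \<longleftrightarrow>
     (\<exists>x\<in>verts G. \<forall>y\<in>verts G. adj G y x \<longrightarrow> (\<forall>z\<in>verts G. adj G z y \<longrightarrow> z = x))"
  by (auto simp: satisfies_def star_sentence_def)

lemma adj_verts: "simple_graph G \<Longrightarrow> adj G u v \<Longrightarrow> u \<in> verts G \<and> v \<in> verts G"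
  by (auto simp: simple_graph_def adj_def)

lemma component_adj_eq:
  assumes "adj G u v"
  shows "component G u = component G v"
proof -
  have "adj G v u" using assms by (simp add: adj_sym)
  with assms show ?thesis
    unfolding component_def by (blast intro: converse_rtranclp_into_rtranclp)
qed

lemma verts_prune: "verts (prune m G) = {v \<in> verts G. m \<le> card (component G v)}"
  by (auto simp: prune_def induced_def)

text \<open>Pruning deletes whole components, so it never cuts an edge at a surviving vertex; one
  endpoint suffices to decide whether an edge survives.\<close>

lemma adj_prune:
  assumes "simple_graph G"
  shows "adj (prune m G) u v \<longleftrightarrow> adj G u v \<and> m \<le> card (component G u)"
  using adj_verts[OF assms, of u v] component_adj_eq[of G u v]
  by (auto simp: prune_def induced_def adj_def)

text \<open>A path from the centre that goes one step to a neighbour can only return. Hence the component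
  of the centre consists of the centre and its neighbours, and pruning forces it to be large.\<close>

lemma star_sentence_imp_large_degree:
  assumes "simple_graph G" and "satisfies (prune m G) star_sentence"
  shows "\<exists>v\<in>verts G. m \<le> Suc (card {w \<in> verts G. adj G v w})"
proof -
  obtain v where v: "v \<in> verts G" "m \<le> card (component G v)"
    and star: "\<forall>y\<in>verts (prune m G). adj (prune m G) y v \<longrightarrow>
      (\<forall>z\<in>verts (prune m G). adj (prune m G) z y \<longrightarrow> z = v)"
    using assms(2) unfolding satisfies_star_sentence verts_prune by blast
  let ?N = "{w \<in> verts G. adj G v w}"
  have returns: "z = v" if "adj G v y" "adj G y z" for y z
  proof -
    have "component G y = component G v" "component G z = component G v"
      using that component_adj_eq by metis+
    then show ?thesis
      using star that v adj_verts[OF assms(1)] adj_sym[of G]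
      unfolding adj_prune[OF assms(1)] verts_prune
      by (metis (no_types, lifting) mem_Collect_eq)
  qed
  have "w \<in> insert v ?N" if "(adj G)\<^sup>*\<^sup>* v w" for w
    using that
  proof induction
    case (step y z)
    then show ?case using returns[of y z] adj_verts[OF assms(1)] by auto
  qed simp
  then have "component G v \<subseteq> insert v ?N"
    by (auto simp: component_def)
  moreover have fin: "finite ?N" using assms(1) by (simp add: simple_graph_def)
  ultimately have "card (component G v) \<le> card (insert v ?N)"
    by (intro card_mono) auto
  also have "\<dots> \<le> Suc (card ?N)" by (rule card_insert_le_m1) (auto simp: fin)
  finally show ?thesis using v by (intro bexI[of _ v]) auto
qed

section \<open>Isolated stars\<close>

text \<open>Graphs on \<^term>\<open>{1..n}\<close> are described by the truth values of their potential edges. That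
  \<open>U\<close> spans a star component with centre \<open>v\<close> is a prescription of the truth values on exactly the
  pairs that meet \<open>U\<close>: the spokes are present and all other such pairs absent.\<close>

definition touching :: "nat \<Rightarrow> nat set \<Rightarrow> nat set set" where
  "touching n U = {e \<in> vertex_pairs n. e \<inter> U \<noteq> {}}"

definition spokes :: "nat \<Rightarrow> nat set \<Rightarrow> nat set set" where
  "spokes v U = (\<lambda>u. {v, u}) ` (U - {v})"

definition isolated_star :: "nat \<Rightarrow> nat set \<Rightarrow> nat \<Rightarrow> (nat set \<Rightarrow> bool) set" where
  "isolated_star n U v = {x. \<forall>e\<in>touching n U. x e \<longleftrightarrow> e \<in> spokes v U}"

abbreviation edge_graph :: "nat \<Rightarrow> (nat set \<Rightarrow> bool) \<Rightarrow> nat graph" where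
  "edge_graph n x \<equiv> \<lparr>verts = {1..n}, edges = {e \<in> vertex_pairs n. x e}\<rparr>"

lemma simple_edge_graph: "simple_graph (edge_graph n x)"
  by (auto simp: simple_graph_def vertex_pairs_def)

lemma finite_vertex_pairs: "finite (vertex_pairs n)"
  by (rule finite_subset[of _ "Pow {1..n}"]) (auto simp: vertex_pairs_def)

lemma finite_touching: "finite (touching n U)"
  using finite_vertex_pairs by (simp add: touching_def)

lemma spokes_subset_touching:
  assumes "U \<subseteq> {1..n}" "v \<in> U"
  shows "spokes v U \<subseteq> touching n U"
  using assms by (auto simp: spokes_def touching_def vertex_pairs_def)

lemma card_spokes: "v \<in> U \<Longrightarrow> card (spokes v U) = card U - 1"
  unfolding spokes_def
  by (subst card_image) (auto simp: inj_on_def doubleton_eq_iff)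

lemma isolated_star_imp_star_sentence:
  assumes x: "x \<in> isolated_star n U v" and U: "U \<subseteq> {1..n}" "v \<in> U"
  shows "satisfies (prune (card U) (edge_graph n x)) star_sentence"
proof -
  let ?G = "edge_graph n x"
  have edge: "adj ?G y z \<longleftrightarrow> {y, z} \<in> spokes v U" if "y \<in> U \<or> z \<in> U" for y z
    using x that spokes_subset_touching[OF U]
    by (auto simp: isolated_star_def adj_def touching_def)
  have "U \<subseteq> component ?G v"
  proof
    fix u assume u: "u \<in> U"
    show "u \<in> component ?G v"
    proof (cases "u = v")
      case False
      then have "adj ?G v u" using u U edge[of v u] by (auto simp: spokes_def)
      then show ?thesis using u U by (auto simp: component_def)
    qed (use U in \<open>auto simp: component_def\<close>)
  qed
  then have large: "card U \<le> card (component ?G v)"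
    by (intro card_mono) (auto simp: component_def)
  have leaf: "z = v" if "adj ?G y v" "adj ?G z y" for y z
  proof -
    have "{y, v} \<in> spokes v U" using that(1) edge U(2) by blast
    then have y: "y \<in> U" "y \<noteq> v" by (auto simp: spokes_def doubleton_eq_iff)
    then have "{z, y} \<in> spokes v U" using that(2) edge by blast
    then have "v \<in> {z, y}" unfolding spokes_def by blast
    then show ?thesis using y(2) by simp
  qed
  show ?thesis
    unfolding satisfies_star_sentence adj_prune[OF simple_edge_graph] verts_prune
  proof (intro bexI[of _ v] ballI impI)
    show "v \<in> {w \<in> verts ?G. card U \<le> card (component ?G w)}" using U large by auto
  qed (use leaf in blast)
qed

text \<open>Distinct components are disjoint, and the centre of a star is unique once the star has three
  vertices (a single edge has two centres). So overlapping pairs contribute nothing to the second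
  moment.\<close>

lemma isolated_stars_disjoint:
  assumes U: "U \<subseteq> {1..n}" "v \<in> U" "card U = k"
    and U': "U' \<subseteq> {1..n}" "v' \<in> U'" "card U' = k"
    and k: "3 \<le> k" and meet: "U \<inter> U' \<noteq> {}" and ne: "(U, v) \<noteq> (U', v')"
  shows "isolated_star n U v \<inter> isolated_star n U' v' = {}"
proof (rule ccontr)
  assume "\<not> ?thesis"
  then obtain x where x: "x \<in> isolated_star n U v" "x \<in> isolated_star n U' v'" by blast
  have fin: "finite U" "finite U'" using U U' finite_subset by auto
  have spoke: "{v, u} \<in> spokes v' U'" if "u \<in> U" "u \<noteq> v" "u \<in> U' \<or> v \<in> U'" for u
  proof -
    have mem: "{v, u} \<in> spokes v U" using that by (auto simp: spokes_def)
    then have "{v, u} \<in> touching n U" using spokes_subset_touching U by blast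
    moreover from this have "{v, u} \<in> touching n U'" using that by (auto simp: touching_def)
    ultimately show ?thesis using x mem by (auto simp: isolated_star_def)
  qed
  have sub: "e \<subseteq> U'" if "e \<in> spokes v' U'" for e using that U' by (auto simp: spokes_def)
  obtain w where w: "w \<in> U" "w \<in> U'" using meet by blast
  \<comment> \<open>A spoke of the first star with one end in \<open>U'\<close> must be a spoke of the second one, so both its
    ends are in \<open>U'\<close>. This brings in first the centre \<open>v\<close>, then all of \<open>U\<close>.\<close>
  have v: "v \<in> U'" using spoke[of w] sub w by (cases "w = v") auto
  then have "U \<subseteq> U'" using spoke sub by blast
  then have eq: "U = U'" using fin U U' by (simp add: card_subset_eq)
  then have "v \<noteq> v'" using ne by simp
  have "card {v, v'} \<le> 2" by (simp add: card_insert_if)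
  then have "\<not> U \<subseteq> {v, v'}" using card_mono[of "{v, v'}" U] U(3) k by auto
  then obtain u where "u \<in> U" "u \<noteq> v" "u \<noteq> v'" by blast
  then show False using spoke[of u] v \<open>v \<noteq> v'\<close> by (auto simp: spokes_def doubleton_eq_iff)
qed

section \<open>First and second moment bounds\<close>

lemma prob_edge_pattern:
  assumes "finite E" "D \<subseteq> E" "0 \<le> p" "p \<le> 1"
  shows "measure_pmf.prob (Pi_pmf E False (\<lambda>_. bernoulli_pmf p)) {x. \<forall>e\<in>D. x e \<longleftrightarrow> e \<in> S}
    = p ^ card (D \<inter> S) * (1 - p) ^ card (D - S)"
proof -
  have "finite D" using assms finite_subset by blast
  have set: "{x. \<forall>e\<in>D. x e \<longleftrightarrow> e \<in> S} = Pi E (\<lambda>e. if e \<in> D then {e \<in> S} else UNIV)"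
    using assms(2) by (auto simp: Pi_def split: if_splits)
  have "measure_pmf.prob (Pi_pmf E False (\<lambda>_. bernoulli_pmf p)) {x. \<forall>e\<in>D. x e \<longleftrightarrow> e \<in> S}
      = (\<Prod>e\<in>E. if e \<in> D then if e \<in> S then p else 1 - p else 1)"
    unfolding set measure_Pi_pmf_Pi[OF assms(1)]
    by (intro prod.cong refl) (use assms in \<open>auto simp: measure_pmf_single split: if_splits\<close>)
  also have "\<dots> = (\<Prod>e\<in>D. if e \<in> S then p else 1 - p)"
    using assms by (simp add: prod.If_cases Int_absorb1)
  also have "\<dots> = p ^ card (D \<inter> S) * (1 - p) ^ card (D - S)"
    using \<open>finite D\<close> by (simp add: prod.If_cases Diff_eq)
  finally show ?thesis .
qed

lemma prob_prune_gnp: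
  "measure_pmf.prob (map_pmf (prune m) (gnp n p)) {G. satisfies G \<phi>} =
   measure_pmf.prob (Pi_pmf (vertex_pairs n) False (\<lambda>_. bernoulli_pmf p))
     {x. satisfies (prune m (edge_graph n x)) \<phi>}"
  by (simp add: gnp_def measure_map_pmf vimage_def)

text \<open>The union bound over all pairs of a centre and \<open>m\<close> neighbours. Dividing by the factorial, that
  is, counting sets of neighbours and not sequences, is what makes the bound useful.\<close>

lemma prob_star_sentence_le:
  assumes p: "0 \<le> p" "p \<le> 1"
  shows "measure_pmf.prob (map_pmf (prune (Suc m)) (gnp n p)) {G. satisfies G star_sentence}
    \<le> real n * (real n * p) ^ m / fact m"
proof -
  let ?M = "Pi_pmf (vertex_pairs n) False (\<lambda>_. bernoulli_pmf p)"
  define I where "I = (SIGMA v:{1..n}. {S. S \<subseteq> {1..n} - {v} \<and> card S = m})"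
  \<comment> \<open>The trivial condition \<open>e \<in> UNIV\<close> gives the event the form of \<open>prob_edge_pattern\<close>.\<close>
  define A where "A i = {x. \<forall>e\<in>(\<lambda>u. {fst i, u}) ` snd i. x e \<longleftrightarrow> e \<in> UNIV}" for i :: "nat \<times> nat set"
  have fin: "finite I" by (auto simp: I_def)
  have cover: "{x. satisfies (prune (Suc m) (edge_graph n x)) star_sentence} \<subseteq> (\<Union>i\<in>I. A i)"
  proof
    fix x assume "x \<in> {x. satisfies (prune (Suc m) (edge_graph n x)) star_sentence}"
    then obtain v where v: "v \<in> {1..n}"
      and "m \<le> card {w \<in> {1..n}. adj (edge_graph n x) v w}"
      using star_sentence_imp_large_degree[OF simple_edge_graph, of "Suc m" n x] by auto
    then obtain S where S: "S \<subseteq> {w \<in> {1..n}. adj (edge_graph n x) v w}" "card S = m"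
      by (meson obtain_subset_with_card_n)
    then have "(v, S) \<in> I" "x \<in> A (v, S)"
      using v by (auto simp: I_def A_def adj_def vertex_pairs_def)
    then show "x \<in> (\<Union>i\<in>I. A i)" by blast
  qed
  have prob: "measure_pmf.prob ?M (A i) = p ^ m" if "i \<in> I" for i
  proof -
    have "inj_on (\<lambda>u. {fst i, u}) (snd i)"
      using that by (auto simp: inj_on_def doubleton_eq_iff)
    then have "card ((\<lambda>u. {fst i, u}) ` snd i) = m"
      using that by (auto simp: card_image I_def)
    moreover have "(\<lambda>u. {fst i, u}) ` snd i \<subseteq> vertex_pairs n"
      using that by (force simp: I_def vertex_pairs_def card_insert_if)
    ultimately show ?thesis
      unfolding A_def using p by (subst prob_edge_pattern) (simp_all add: finite_vertex_pairs)
  qed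
  have "card I = n * ((n - 1) choose m)"
    unfolding I_def by (subst card_SigmaI) (auto simp: n_subsets)
  then have "card I * fact m \<le> n * n ^ m"
    using binomial_fact_pow[of "n - 1" m] power_mono[of "n - 1" n m]
    by (auto simp: mult.assoc intro!: mult_left_mono)
  then have "real (card I * fact m) \<le> real (n * n ^ m)" by (simp only: of_nat_le_iff)
  then have card: "real (card I) \<le> real n * real n ^ m / fact m"
    by (simp add: field_simps)
  have "measure_pmf.prob ?M {x. satisfies (prune (Suc m) (edge_graph n x)) star_sentence}
      \<le> measure_pmf.prob ?M (\<Union>i\<in>I. A i)"
    using cover by (intro measure_pmf.finite_measure_mono) auto
  also have "\<dots> \<le> (\<Sum>i\<in>I. measure_pmf.prob ?M (A i))"
    using fin by (intro measure_pmf.finite_measure_subadditive_finite) auto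
  also have "\<dots> = real (card I) * p ^ m" by (simp add: prob)
  also have "\<dots> \<le> real n * real n ^ m / fact m * p ^ m"
    using card p by (intro mult_right_mono) auto
  finally show ?thesis unfolding prob_prune_gnp by (simp add: power_mult_distrib mult.assoc)
qed

text \<open>If \<open>X\<close> counts the events that occur, the indicator of their union is at least
  \<open>1 - (1 - X / \<mu>)\<^sup>2\<close>; the bound is the expectation of this.\<close>

lemma second_moment_union:
  fixes M :: "'a pmf" and A :: "'i \<Rightarrow> 'a set"
  defines "\<mu> I \<equiv> (\<Sum>i\<in>I. measure_pmf.prob M (A i))"
  assumes fin: "finite I" and pos: "\<mu> I > 0" and r: "r \<ge> 0"
    and pair: "\<And>i j. i \<in> I \<Longrightarrow> j \<in> I \<Longrightarrow> i \<noteq> j \<Longrightarrow>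
      measure_pmf.prob M (A i \<inter> A j) \<le> r * measure_pmf.prob M (A i) * measure_pmf.prob M (A j)"
  shows "2 - 1 / \<mu> I - r \<le> measure_pmf.prob M (\<Union>i\<in>I. A i)"
proof -
  let ?m = "\<mu> I"
  let ?P = "measure_pmf.prob M"
  define X :: "'a \<Rightarrow> real" where "X x = (\<Sum>i\<in>I. indicator (A i) x)" for x
  have sq: "(X x)\<^sup>2 = (\<Sum>i\<in>I. \<Sum>j\<in>I. indicator (A i \<inter> A j) x)" for x
    by (simp add: X_def power2_eq_square sum_product indicator_inter_arith)
  have "(\<Sum>i\<in>I. \<Sum>j\<in>I. ?P (A i \<inter> A j)) \<le>
      (\<Sum>i\<in>I. \<Sum>j\<in>I. (if i = j then ?P (A i) else 0) + r * ?P (A i) * ?P (A j))"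
    using pair r by (intro sum_mono) auto
  also have "\<dots> = ?m + (\<Sum>i\<in>I. \<Sum>j\<in>I. r * ?P (A i) * ?P (A j))"
    using fin by (simp add: sum.distrib \<mu>_def)
  also have "(\<Sum>i\<in>I. \<Sum>j\<in>I. r * ?P (A i) * ?P (A j)) = r * ?m\<^sup>2"
    unfolding \<mu>_def power2_eq_square sum_product by (simp add: sum_distrib_left mult.assoc)
  finally have second: "(\<Sum>i\<in>I. \<Sum>j\<in>I. ?P (A i \<inter> A j)) \<le> ?m + r * ?m\<^sup>2" .
  have ind: "integrable M (indicat_real B)" for B
    by (rule measure_pmf.integrable_const_bound[where B = 1]) auto
  have X: "integrable M X" "measure_pmf.expectation M X = ?m"
    unfolding X_def by (simp_all add: \<mu>_def ind)
  have X2: "integrable M (\<lambda>x. (X x)\<^sup>2)"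
    "measure_pmf.expectation M (\<lambda>x. (X x)\<^sup>2) = (\<Sum>i\<in>I. \<Sum>j\<in>I. ?P (A i \<inter> A j))"
    unfolding sq by (simp_all add: ind)
  have "2 - 1 / ?m - r = 2 / ?m * ?m - (?m + r * ?m\<^sup>2) / ?m\<^sup>2"
    using pos by (simp add: field_simps power2_eq_square)
  also have "\<dots> \<le> 2 / ?m * ?m - (\<Sum>i\<in>I. \<Sum>j\<in>I. ?P (A i \<inter> A j)) / ?m\<^sup>2"
    using second by (intro diff_left_mono divide_right_mono) auto
  also have "\<dots> = measure_pmf.expectation M (\<lambda>x. 2 / ?m * X x - (X x)\<^sup>2 / ?m\<^sup>2)"
    using X X2 by simp
  also have "\<dots> \<le> measure_pmf.expectation M (indicator (\<Union>i\<in>I. A i))"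
  proof (rule integral_mono)
    show "integrable (measure_pmf M) (\<lambda>x. 2 / ?m * X x - (X x)\<^sup>2 / ?m\<^sup>2)"
      using X X2 by simp
    show "2 / ?m * X x - (X x)\<^sup>2 / ?m\<^sup>2 \<le> indicator (\<Union>i\<in>I. A i) x" for x
    proof (cases "x \<in> (\<Union>i\<in>I. A i)")
      case True
      have "0 \<le> (1 - X x / ?m)\<^sup>2" by simp
      then show ?thesis using True by (simp add: power2_diff power_divide)
    next
      case False
      then have "X x = 0" by (auto simp: X_def)
      then show ?thesis using False by simp
    qed
  qed (rule ind)
  also have "\<dots> = ?P (\<Union>i\<in>I. A i)" by simp
  finally show ?thesis .
qed

lemma card_touching_le:
  assumes "U \<subseteq> {1..n}"
  shows "card (touching n U) \<le> card U * n"
proof -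
  have "touching n U \<subseteq> (\<lambda>(u, w). {u, w}) ` (U \<times> {1..n})"
    by (force simp: touching_def vertex_pairs_def card_2_iff doubleton_eq_iff)
  moreover have "finite (U \<times> {1..n})" using assms finite_subset by auto
  ultimately have "card (touching n U) \<le> card (U \<times> {1..n})"
    by (meson surj_card_le)
  then show ?thesis by (simp add: card_cartesian_product)
qed

lemma card_touching_both_le:
  assumes "finite U" "finite U'" "U \<inter> U' = {}"
  shows "card (touching n U \<inter> touching n U') \<le> card U * card U'"
proof -
  have "touching n U \<inter> touching n U' \<subseteq> (\<lambda>(u, w). {u, w}) ` (U \<times> U')"
  proof
    fix e assume "e \<in> touching n U \<inter> touching n U'"
    then obtain u w where "u \<in> e" "u \<in> U" "w \<in> e" "w \<in> U'" "card e = 2"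
      by (auto simp: touching_def vertex_pairs_def)
    moreover from this have "e = {u, w}" using assms(3) by (auto simp: card_2_iff)
    ultimately show "e \<in> (\<lambda>(u, w). {u, w}) ` (U \<times> U')" by blast
  qed
  then have "card (touching n U \<inter> touching n U') \<le> card (U \<times> U')"
    by (rule surj_card_le[rotated]) (simp add: assms)
  then show ?thesis by (simp add: card_cartesian_product)
qed

lemma prob_isolated_star:
  assumes "U \<subseteq> {1..n}" "v \<in> U" "0 \<le> p" "p \<le> 1"
  shows "measure_pmf.prob (Pi_pmf (vertex_pairs n) False (\<lambda>_. bernoulli_pmf p)) (isolated_star n U v)
    = p ^ (card U - 1) * (1 - p) ^ card (touching n U - spokes v U)"
proof -
  have "touching n U \<inter> spokes v U = spokes v U" using spokes_subset_touching assms by blast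
  then show ?thesis
    unfolding isolated_star_def using assms
    by (subst prob_edge_pattern) (auto simp: finite_vertex_pairs touching_def card_spokes)
qed

text \<open>Disjoint stars are almost independent. The two prescriptions concern different pairs except
  for those joining \<open>U\<close> to \<open>U'\<close>, which both require to be absent; the product of the two
  probabilities pays for these pairs twice.\<close>

lemma prob_two_isolated_stars_le:
  fixes n :: nat and p :: real
  defines "P \<equiv> measure_pmf.prob (Pi_pmf (vertex_pairs n) False (\<lambda>_. bernoulli_pmf p))"
  assumes U: "U \<subseteq> {1..n}" "v \<in> U" and U': "U' \<subseteq> {1..n}" "v' \<in> U'"
    and disj: "U \<inter> U' = {}" and p: "0 \<le> p" "p < 1"
  shows "P (isolated_star n U v \<inter> isolated_star n U' v')
    \<le> 1 / (1 - p) ^ (card U * card U') * P (isolated_star n U v) * P (isolated_star n U' v')"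
proof -
  let ?T = "touching n U" and ?T' = "touching n U'"
  let ?S = "spokes v U" and ?S' = "spokes v' U'"
  let ?B = "?T - ?S" and ?B' = "?T' - ?S'"
  let ?both = "P (isolated_star n U v \<inter> isolated_star n U' v')"
  have fin: "finite U" "finite U'" using U U' finite_subset by auto
  have S: "?S \<subseteq> ?T" "?S' \<subseteq> ?T'" using spokes_subset_touching U U' by auto
  have cross: "?T \<inter> ?S' = {}" "?T' \<inter> ?S = {}"
    using disj U U' by (auto simp: touching_def spokes_def)
  have finS: "finite ?S" "finite ?S'" using fin by (auto simp: spokes_def)
  have pattern: "isolated_star n U v \<inter> isolated_star n U' v' =
      {x. \<forall>e\<in>?T \<union> ?T'. x e \<longleftrightarrow> e \<in> ?S \<union> ?S'}"
    using cross by (auto simp: isolated_star_def)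
  have sets: "(?T \<union> ?T') \<inter> (?S \<union> ?S') = ?S \<union> ?S'" "?S \<inter> ?S' = {}"
      "?T \<union> ?T' - (?S \<union> ?S') = ?B \<union> ?B'"
    using S cross by auto
  have both: "?both = p ^ (card U - 1 + (card U' - 1)) * (1 - p) ^ card (?B \<union> ?B')"
  proof -
    have sub: "?T \<union> ?T' \<subseteq> vertex_pairs n" by (auto simp: touching_def)
    show ?thesis
      unfolding P_def pattern prob_edge_pattern[OF finite_vertex_pairs sub p(1) less_imp_le[OF p(2)]] sets
      using U U' by (simp add: sets card_Un_disjoint finS card_spokes)
  qed
  have "card (?B \<inter> ?B') \<le> card (?T \<inter> ?T')"
    by (intro card_mono) (auto simp: finite_touching)
  also have "\<dots> \<le> card U * card U'" using card_touching_both_le fin disj by blast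
  finally have "(1 - p) ^ (card U * card U') \<le> (1 - p) ^ card (?B \<inter> ?B')"
    using p by (intro power_decreasing) auto
  moreover have "0 \<le> ?both" by (simp add: P_def)
  ultimately have "?both * (1 - p) ^ (card U * card U') \<le> ?both * (1 - p) ^ card (?B \<inter> ?B')"
    by (rule mult_left_mono)
  also have "\<dots> = p ^ (card U - 1 + (card U' - 1)) * (1 - p) ^ (card (?B \<union> ?B') + card (?B \<inter> ?B'))"
    by (simp add: both power_add)
  also have "card (?B \<union> ?B') + card (?B \<inter> ?B') = card ?B + card ?B'"
    by (rule card_Un_Int[symmetric]) (auto simp: finite_touching)
  also have "p ^ (card U - 1 + (card U' - 1)) * (1 - p) ^ (card ?B + card ?B') =
      P (isolated_star n U v) * P (isolated_star n U' v')"
    using U U' p by (simp add: P_def prob_isolated_star power_add)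
  finally show ?thesis using p by (simp add: field_simps)
qed

text \<open>The second-moment bound is applied to the star components on exactly \<open>k\<close> vertices. The
  numerical hypotheses give \<open>\<mu> \<ge> 4\<close> and a correlation factor of at most \<open>5/4\<close>, and
  \<open>2 - 1/4 - 5/4 = 1/2\<close>.\<close>

lemma prob_star_sentence_ge:
  fixes c :: real and n k :: nat
  assumes k: "3 \<le> k" "k \<le> n" and c: "0 < c" "c \<le> 1" "real k * c \<le> 1 / 2"
    and overlap: "(real k)\<^sup>2 * (c / real n) \<le> 1 / 5" and many: "8 \<le> real n * (c / real k) ^ k"
  shows "1 / 2 \<le> measure_pmf.prob (map_pmf (prune k) (gnp n (c / real n))) {G. satisfies G star_sentence}"
proof -
  define p where "p = c / real n"
  let ?M = "Pi_pmf (vertex_pairs n) False (\<lambda>_. bernoulli_pmf p)"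
  let ?P = "measure_pmf.prob ?M"
  define I where "I = (SIGMA U:{U. U \<subseteq> {1..n} \<and> card U = k}. U)"
  define A where "A i = isolated_star n (fst i) (snd i)" for i :: "nat set \<times> nat"
  define r where "r = 1 / (1 - p) ^ (k * k)"
  define \<mu> where "\<mu> = (\<Sum>i\<in>I. ?P (A i))"
  have n: "real n > 0" using k by simp
  have "p \<le> c / 3" using c k unfolding p_def by (intro divide_left_mono) auto
  then have "p < 1" using c by linarith
  moreover have "0 < p" using c n by (simp add: p_def)
  ultimately have p: "0 < p" "p < 1" by simp_all
  have fin: "finite I"
    unfolding I_def by (intro finite_SigmaI) (auto intro: finite_subset)
  have I: "fst i \<subseteq> {1..n}" "snd i \<in> fst i" "card (fst i) = k" if "i \<in> I" for i
    using that by (auto simp: I_def)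
  have single: "p ^ (k - 1) / 2 \<le> ?P (A i)" if "i \<in> I" for i
  proof -
    let ?B = "touching n (fst i) - spokes (snd i) (fst i)"
    have "card ?B \<le> card (touching n (fst i))" by (simp add: card_mono finite_touching)
    also have "\<dots> \<le> k * n" using card_touching_le I[OF that] by metis
    finally have "(1 - p) ^ (k * n) \<le> (1 - p) ^ card ?B"
      using p by (intro power_decreasing) auto
    moreover have "1 - real (k * n) * p \<le> (1 - p) ^ (k * n)"
      using Bernoulli_inequality[of "- p" "k * n"] p by simp
    moreover have "real (k * n) * p \<le> 1 / 2" using c n by (simp add: p_def)
    ultimately have "1 / 2 \<le> (1 - p) ^ card ?B" by linarith
    then have "p ^ (k - 1) * (1 / 2) \<le> p ^ (k - 1) * (1 - p) ^ card ?B"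
      using p by (intro mult_left_mono) auto
    then show ?thesis using I[OF that] p by (simp add: A_def prob_isolated_star)
  qed
  have "card I = (n choose k) * k"
    unfolding I_def by (subst card_SigmaI) (auto simp: n_subsets intro: finite_subset)
  then have "n choose k \<le> card I" using k by simp
  then have "(real n / real k) ^ k \<le> real (card I)"
    using binomial_ge_n_over_k_pow_k[of k n, where 'a = real] k by linarith
  have "real n * (c / real k) ^ k / 2 \<le> real n * (c / real k) ^ k / 2 / c"
  proof -
    have "x \<le> x / c" if "0 \<le> x" for x
      using that c by (simp add: pos_le_divide_eq mult_left_le)
    then show ?thesis using many by simp
  qed
  also have "\<dots> = (real n / real k) ^ k * (p ^ (k - 1) / 2)"
  proof -
    have "(real n / real k) ^ k * p ^ k = (c / real k) ^ k"
      using n unfolding power_mult_distrib[symmetric] by (simp add: p_def)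
    moreover have "p ^ (k - 1) = p ^ k / p" using k p by (simp add: power_diff)
    ultimately have "(real n / real k) ^ k * p ^ (k - 1) = (c / real k) ^ k / p" by simp
    then show ?thesis using c n by (simp add: p_def mult.commute)
  qed
  also have "\<dots> \<le> real (card I) * (p ^ (k - 1) / 2)"
    using p \<open>(real n / real k) ^ k \<le> real (card I)\<close> by (intro mult_right_mono) auto
  also have "\<dots> \<le> \<mu>"
    unfolding \<mu>_def using sum_mono[of I "\<lambda>_. p ^ (k - 1) / 2" "\<lambda>i. ?P (A i)"] single by simp
  finally have \<mu>: "4 \<le> \<mu>" using many by linarith
  have "1 - real (k * k) * p \<le> (1 - p) ^ (k * k)"
    using Bernoulli_inequality[of "- p" "k * k"] p by simp
  then have "4 / 5 \<le> (1 - p) ^ (k * k)" using overlap by (simp add: p_def power2_eq_square)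
  then have r: "r \<le> 5 / 4" "0 \<le> r" using p by (auto simp: r_def field_simps)
  have pair: "?P (A i \<inter> A j) \<le> r * ?P (A i) * ?P (A j)" if "i \<in> I" "j \<in> I" "i \<noteq> j" for i j
  proof (cases "fst i \<inter> fst j = {}")
    case True
    then show ?thesis
      using prob_two_isolated_stars_le[OF I(1,2)[OF that(1)] I(1,2)[OF that(2)] True, of p] p
        I(3) that by (simp add: A_def r_def)
  next
    case False
    then have "A i \<inter> A j = {}"
      unfolding A_def using I[OF that(1)] I[OF that(2)] k that(3)
      by (intro isolated_stars_disjoint[where k = k]) (auto simp: prod_eq_iff)
    then show ?thesis using r by simp
  qed
  have "1 / \<mu> \<le> 1 / 4" using \<mu> by (intro divide_left_mono) auto
  then have "1 / 2 \<le> 2 - 1 / \<mu> - r" using r by linarith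
  also have "\<dots> \<le> ?P (\<Union>i\<in>I. A i)"
    unfolding \<mu>_def by (rule second_moment_union) (use fin r pair \<mu> in \<open>auto simp: \<mu>_def\<close>)
  also have "\<dots> \<le> ?P {x. satisfies (prune k (edge_graph n x)) star_sentence}"
  proof (rule measure_pmf.finite_measure_mono)
    show "(\<Union>i\<in>I. A i) \<subseteq> {x. satisfies (prune k (edge_graph n x)) star_sentence}"
    proof (intro UN_least subsetI CollectI)
      fix i x assume "i \<in> I" "x \<in> A i"
      then show "satisfies (prune k (edge_graph n x)) star_sentence"
        using isolated_star_imp_star_sentence[of x n "fst i" "snd i"] I[of i] by (simp only: A_def)
    qed
  qed simp
  finally show ?thesis by (simp only: prob_prune_gnp p_def)
qed

section \<open>Choice of the parameters\<close>

text \<open>The reciprocal of \<open>c n\<close>. The two summands 1 keep it at least one for all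
  \<open>n \<ge> 1\<close>.\<close>

definition sparsity :: "nat \<Rightarrow> real" where
  "sparsity n = 1 + ln (1 + ln (real n))"

text \<open>Writing \<open>l\<close> for the sparsity, the order of \<open>m = ln n / sqrt l\<close> is chosen between two
  thresholds. The size condition needs \<open>m ln l = o(ln n)\<close>, while \<open>m!\<close> exceeds \<open>n\<close> because
  \<open>ln (m!)\<close> is of order \<open>m ln m\<close>, here \<open>ln n sqrt l\<close>.\<close>

definition rare_size :: "nat \<Rightarrow> nat" where
  "rare_size n = nat \<lceil>ln (real n) / sqrt (sparsity n)\<rceil>"

text \<open>Any slowly growing size serves here; it must be small compared with the sparsity, so that a
  set of \<open>k\<close> vertices sends no edge outside with probability bounded away from zero. The summand 3
  ensures that stars have a unique centre.\<close>

definition frequent_size :: "nat \<Rightarrow> nat" where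
  "frequent_size n = nat \<lfloor>sqrt (sparsity n)\<rfloor> + 3"

lemma sparsity_ge_1: "n \<ge> 1 \<Longrightarrow> sparsity n \<ge> 1"
  by (simp add: sparsity_def)

lemma filterlim_rare_size: "filterlim rare_size at_top sequentially"
  unfolding rare_size_def sparsity_def by real_asymp

lemma filterlim_frequent_size: "filterlim frequent_size at_top sequentially"
  unfolding frequent_size_def sparsity_def by real_asymp

lemma rare_size_smallo:
  "(\<lambda>n. real (Suc (rare_size n)) * ln (1 / (1 / sparsity n))) \<in> o(\<lambda>n. ln (real n))"
  unfolding rare_size_def sparsity_def by real_asymp

lemma frequent_size_smallo:
  "(\<lambda>n. real (frequent_size n) * ln (1 / (1 / sparsity n))) \<in> o(\<lambda>n. ln (real n))"
  unfolding frequent_size_def sparsity_def by real_asymp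

text \<open>The weak form \<open>m! \<ge> (m / e)\<^sup>m\<close> of Stirling's formula, from one term of the exponential
  series.\<close>

lemma inverse_fact_le:
  assumes "m > 0"
  shows "1 / fact m \<le> exp (real m - real m * ln (real m))"
proof -
  have "(\<lambda>k. real m ^ k /\<^sub>R fact k) sums exp (real m)" by (rule exp_converges)
  then have "(\<Sum>k\<in>{m}. real m ^ k /\<^sub>R fact k) \<le> exp (real m)"
    using sum_le_suminf[of "\<lambda>k. real m ^ k /\<^sub>R fact k" "{m}"] by (simp add: sums_iff)
  then have "real m ^ m / fact m \<le> exp (real m)" by (simp add: field_simps)
  moreover have "real m ^ m = exp (real m * ln (real m))"
    using assms by (simp add: exp_of_nat_mult)
  ultimately show ?thesis by (simp add: exp_diff field_simps)
qed

lemma eventually_rare: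
  "\<forall>\<^sub>F n in sequentially. measure_pmf.prob
     (map_pmf (prune (Suc (rare_size n))) (gnp n (1 / sparsity n / real n)))
     {G. satisfies G star_sentence} \<le> 1 / 4"
proof -
  have "\<forall>\<^sub>F n in sequentially.
      real n * exp (real (rare_size n) - real (rare_size n) * ln (real (rare_size n))) \<le> 1 / 4"
    unfolding rare_size_def sparsity_def by real_asymp
  moreover have "\<forall>\<^sub>F n in sequentially. rare_size n \<ge> 1"
    using filterlim_rare_size by (simp add: filterlim_at_top)
  ultimately show ?thesis
    using eventually_ge_at_top[of 1]
  proof eventually_elim
    case (elim n)
    let ?m = "rare_size n"
    have s: "sparsity n \<ge> 1" using elim sparsity_ge_1 by simp
    have "1 / sparsity n / real n \<le> 1 / 1 / 1"
      using s elim by (intro frac_le) auto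
    then have "measure_pmf.prob (map_pmf (prune (Suc ?m)) (gnp n (1 / sparsity n / real n)))
        {G. satisfies G star_sentence} \<le> real n * (real n * (1 / sparsity n / real n)) ^ ?m / fact ?m"
      using s by (intro prob_star_sentence_le) auto
    also have "\<dots> \<le> real n * 1 / fact ?m"
      using s elim by (intro divide_right_mono mult_left_mono power_le_one) auto
    also have "\<dots> \<le> real n * exp (real ?m - real ?m * ln (real ?m))"
      using mult_left_mono[OF inverse_fact_le[of ?m], of "real n"] elim by simp
    finally show ?case using elim by linarith
  qed
qed

lemma eventually_frequent:
  "\<forall>\<^sub>F n in sequentially. 1 / 2 \<le> measure_pmf.prob
     (map_pmf (prune (frequent_size n)) (gnp n (1 / sparsity n / real n)))
     {G. satisfies G star_sentence}"
proof -
  \<comment> \<open>This is \<open>n (c / k)\<^sup>k\<close>, a lower bound for the expected number of stars up to a constant.\<close>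
  have "\<forall>\<^sub>F n in sequentially.
      real n * exp (- real (frequent_size n) * ln (real (frequent_size n) * sparsity n)) \<ge> 8"
    unfolding frequent_size_def sparsity_def by real_asymp
  moreover have "\<forall>\<^sub>F n in sequentially. real (frequent_size n) * (1 / sparsity n) \<le> 1 / 2"
    unfolding frequent_size_def sparsity_def by real_asymp
  moreover have "\<forall>\<^sub>F n in sequentially. (real (frequent_size n))\<^sup>2 * (1 / sparsity n / real n) \<le> 1 / 5"
    unfolding frequent_size_def sparsity_def by real_asymp
  moreover have "\<forall>\<^sub>F n in sequentially. frequent_size n \<le> n"
    unfolding frequent_size_def sparsity_def by real_asymp
  ultimately show ?thesis
    using eventually_ge_at_top[of 1]
  proof eventually_elim
    case (elim n)
    let ?k = "frequent_size n"
    have s: "sparsity n \<ge> 1" using elim sparsity_ge_1 by simp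
    have k: "3 \<le> ?k" by (simp add: frequent_size_def)
    then have pos: "real ?k * sparsity n > 0" using s by simp
    have "exp (- real ?k * ln (real ?k * sparsity n)) = inverse (exp (ln (real ?k * sparsity n)) ^ ?k)"
      by (simp add: exp_minus exp_of_nat_mult)
    also have "\<dots> = (1 / sparsity n / real ?k) ^ ?k"
      using pos by (simp add: field_simps)
    finally have "8 \<le> real n * (1 / sparsity n / real ?k) ^ ?k" using elim by simp
    then show ?case
      using s k elim by (intro prob_star_sentence_ge) auto
  qed
qed

theorem proposition3p3:
  "\<exists>(c :: nat \<Rightarrow> real) (f :: nat \<Rightarrow> nat).
     (\<forall>n\<ge>1. c n > 0) \<and> c \<longlonglongrightarrow> 0 \<and>
     (\<forall>n\<ge>1. f n \<ge> 1) \<and> filterlim f at_top sequentially \<and>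
     (\<lambda>n. ln (1 / c n)) \<in> o(\<lambda>n. ln (real n)) \<and>
     (\<lambda>n. real (f n) * ln (1 / c n)) \<in> o(\<lambda>n. ln (real n)) \<and>
     \<not> fo_zero_one_law (\<lambda>n. map_pmf (prune (f n)) (gnp n (c n / real n)))"
proof -
  define c where "c n = 1 / sparsity n" for n
  define f where "f n = (if even n then frequent_size n else Suc (rare_size n))" for n
  let ?p = "\<lambda>n. measure_pmf.prob (map_pmf (prune (f n)) (gnp n (c n / real n)))
    {G. satisfies G star_sentence}"
  have c_pos: "\<forall>n\<ge>1. c n > 0"
    using sparsity_ge_1 by (force simp: c_def)
  have c_lim: "c \<longlonglongrightarrow> 0"
    unfolding c_def sparsity_def by real_asymp
  have f_pos: "\<forall>n\<ge>1. f n \<ge> 1"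
    by (simp add: f_def frequent_size_def)
  have f_lim: "filterlim f at_top sequentially"
    unfolding filterlim_at_top
  proof
    fix Z
    have "\<forall>\<^sub>F n in sequentially. Z \<le> frequent_size n" "\<forall>\<^sub>F n in sequentially. Z \<le> rare_size n"
      using filterlim_frequent_size filterlim_rare_size by (auto simp: filterlim_at_top)
    then show "\<forall>\<^sub>F n in sequentially. Z \<le> f n"
      by eventually_elim (simp add: f_def)
  qed
  have c_small: "(\<lambda>n. ln (1 / c n)) \<in> o(\<lambda>n. ln (real n))"
    unfolding c_def sparsity_def by real_asymp
  have f_small: "(\<lambda>n. real (f n) * ln (1 / c n)) \<in> o(\<lambda>n. ln (real n))"
  proof (rule landau_o.smallI)
    fix \<epsilon> :: real assume "\<epsilon> > 0"
    from landau_o.smallD[OF rare_size_smallo this] landau_o.smallD[OF frequent_size_smallo this]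
    show "\<forall>\<^sub>F n in sequentially. norm (real (f n) * ln (1 / c n)) \<le> \<epsilon> * norm (ln (real n))"
      by eventually_elim (simp add: f_def c_def)
  qed
  have even_ge: "\<forall>\<^sub>F n in sequentially. even n \<longrightarrow> 1 / 2 \<le> ?p n"
    using eventually_frequent by eventually_elim (simp add: f_def c_def)
  have odd_le: "\<forall>\<^sub>F n in sequentially. odd n \<longrightarrow> ?p n \<le> 1 / 4"
    using eventually_rare by eventually_elim (simp add: f_def c_def)
  have "\<not> ?p \<longlonglongrightarrow> 0"
  proof
    assume "?p \<longlonglongrightarrow> 0"
    then have "\<forall>\<^sub>F n in sequentially. ?p n < 1 / 2"
      by (rule order_tendstoD(2)) simp
    with even_ge have "\<forall>\<^sub>F n in sequentially. odd n"
      by eventually_elim auto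
    then have "\<exists>N::nat. \<forall>n\<ge>N. odd n" by (simp only: eventually_sequentially)
    then obtain N :: nat where N: "\<forall>n\<ge>N. odd n" ..
    have "odd (2 * N)" using spec[OF N, of "2 * N"] by simp
    then show False by simp
  qed
  moreover have "\<not> ?p \<longlonglongrightarrow> 1"
  proof
    assume "?p \<longlonglongrightarrow> 1"
    then have "\<forall>\<^sub>F n in sequentially. 1 / 4 < ?p n"
      by (rule order_tendstoD(1)) simp
    with odd_le have "\<forall>\<^sub>F n in sequentially. even n"
      by eventually_elim auto
    then have "\<exists>N::nat. \<forall>n\<ge>N. even n" by (simp only: eventually_sequentially)
    then obtain N :: nat where N: "\<forall>n\<ge>N. even n" ..
    have "even (Suc (2 * N))" using spec[OF N, of "Suc (2 * N)"] by simp
    then show False by simp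
  qed
  ultimately have "\<not> fo_zero_one_law (\<lambda>n. map_pmf (prune (f n)) (gnp n (c n / real n)))"
    unfolding fo_zero_one_law_def using sentence_star_sentence by blast
  with c_pos c_lim f_pos f_lim c_small f_small show ?thesis
    by (intro exI[of _ c] exI[of _ f] conjI)
qed

end
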